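(* Let $R$ be an integral domain with fraction field $K$. Then the following statements hold. (i) Each prime ideal $\mathfrak{p} \subset R$ of height one is of the form $\mathfrak{p} = M \cap R$ for some Mathieu subspace $M$ of $K$ over $R$. (ii) If $r \in R$ is anti-Archimedean, i.e. $\bigcap_{n=1}^{\infty} r^n R \neq (0)$, then there is no proper Mathieu subspace of $K$ over $R$ that contains $r$.
   Context: A Mathieu subspace of $K$ over $R$ is an $R$-submodule $M$ of $K$ such that for all $a, b \in K$: if $a^m \in M$ for all $m \ge 1$, then $b a^m \in M$ for all sufficiently large $m$. It is proper if $M \ne K$. *)

theory Defs
  imports "HOL-Algebra.Algebra" "HOL-Library.Extended_Nat"
begin

text \<open>
  An integral domain \<open>R\<close> and its fraction field \<open>K\<close>. The domain is identified with its image
  in \<open>K\<close>, so \<open>R\<close> is a subset of the carrier of \<open>K\<close>; as a ring in its own right it is the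
  record \<open>K\<lparr>carrier := R\<rparr>\<close>.
\<close>

locale fraction_field = field K + subdomain R K for R and K (structure) +
  assumes fraction: "x \<in> carrier K \<Longrightarrow> \<exists>a\<in>R. \<exists>b\<in>R - {\<zero>}. x = a \<otimes> inv b"

definition self_module :: "('a, 'b) ring_scheme \<Rightarrow> ('a, 'a) module" where
  "self_module K = \<lparr>carrier = carrier K, monoid.mult = monoid.mult K, one = one K,
     ring.zero = ring.zero K, add = add K, smult = monoid.mult K\<rparr>"

lemma (in fraction_field) self_module_algebra:
  "algebra (K\<lparr>carrier := R\<rparr>) (self_module K)"
proof -
  have R_sub: "subcring R K" by unfold_locales
  have K_cring: "cring (self_module K)"
  proof (intro cringI abelian_groupI comm_monoidI)
    fix x assume "x \<in> carrier (self_module K)"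
    then show "\<exists>y\<in>carrier (self_module K). y \<oplus>\<^bsub>self_module K\<^esub> x = \<zero>\<^bsub>self_module K\<^esub>"
      by (auto simp: self_module_def intro!: bexI[of _ "\<ominus> x"] l_neg)
  qed (auto simp: self_module_def a_assoc m_assoc l_distr intro: a_comm m_comm)
  have "R \<subseteq> carrier K" by (rule subset)
  then show ?thesis
    using subcring_iff[of R] R_sub K_cring
    by (intro algebraI) (auto simp: self_module_def l_distr r_distr m_assoc subset_iff)
qed

text \<open>Only meant for \<open>algebra R A\<close>; in particular \<open>A\<close> is commutative.\<close>

definition mathieu_subspace ::
  "('r, 'c) ring_scheme \<Rightarrow> ('r, 'a, 'd) module_scheme \<Rightarrow> 'a set \<Rightarrow> bool" where
  "mathieu_subspace R A M \<longleftrightarrow> submodule M R A \<and>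
     (\<forall>a\<in>carrier A. \<forall>b\<in>carrier A.
        (\<forall>m::nat. m \<ge> 1 \<longrightarrow> a [^]\<^bsub>A\<^esub> m \<in> M) \<longrightarrow>
        (\<exists>N::nat. \<forall>m\<ge>N. b \<otimes>\<^bsub>A\<^esub> (a [^]\<^bsub>A\<^esub> m) \<in> M))"

text \<open>
  Only meant for prime ideals \<open>P\<close>. The length of a chain is its number of strict inclusions, so in
  a domain the zero ideal has height 0.
\<close>

definition height :: "('a, 'b) ring_scheme \<Rightarrow> 'a set \<Rightarrow> enat" where
  "height R P = (SUP n \<in> {n. \<exists>Q. Q n = P \<and> (\<forall>i\<le>n. primeideal (Q i) R) \<and>
                                 (\<forall>i<n. Q i \<subset> Q (Suc i))}. enat n)"

definition anti_archimedean :: "('a, 'b) ring_scheme \<Rightarrow> 'a \<Rightarrow> bool" where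
  "anti_archimedean R r \<longleftrightarrow> (\<Inter>n\<in>{1::nat..}. PIdl\<^bsub>R\<^esub> (r [^]\<^bsub>R\<^esub> n)) \<noteq> {\<zero>\<^bsub>R\<^esub>}"

end

theory Submission
  imports Defs
begin

text \<open>
  Part (i): the witness is the extension \<open>P R\<^bsub>P\<^esub>\<close> of \<open>P\<close> to the localization at \<open>P\<close>. It contracts
  to \<open>P\<close> because \<open>P\<close> is prime. It is a Mathieu subspace because height one makes \<open>R\<^bsub>P\<^esub>\<close>
  one-dimensional: inverting any nonzero \<open>a \<in> P R\<^bsub>P\<^esub>\<close> already yields all of \<open>K\<close>, so for each
  \<open>b \<in> K\<close> some \<open>b a\<^sup>n\<close> lies in \<open>R\<^bsub>P\<^esub>\<close>, and every further factor \<open>a\<close> moves the product into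
  \<open>P R\<^bsub>P\<^esub>\<close>. In terms of elements, the one-dimensionality says that each nonzero \<open>d \<in> R\<close> divides
  some \<open>s x\<^sup>n\<close> with \<open>s \<notin> P\<close>, for any nonzero \<open>x \<in> P\<close>; otherwise a prime ideal containing \<open>d\<close> and
  avoiding all \<open>s x\<^sup>n\<close>, which \<open>exists_primeideal_avoiding\<close> supplies, would lie strictly between
  \<open>0\<close> and \<open>P\<close>. This is \<open>power_multiple_if_height_le_one\<close>.

  Part (ii): if \<open>c \<noteq> 0\<close> is divisible in \<open>R\<close> by all powers of \<open>r\<close>, then applying the Mathieu
  condition to \<open>r\<close> and \<open>b / c\<close> puts \<open>(b / c) r\<^sup>m\<close> into \<open>M\<close> for all large \<open>m\<close>. As \<open>b\<close> is an \<open>R\<close>-multiple of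
  that element, every \<open>b \<in> K\<close> lies in \<open>M\<close>.
\<close>

section \<open>Primes avoiding a multiplicative set, and height one\<close>

text \<open>
  Zorn's lemma provides an ideal \<open>Q\<close> that is maximal among those containing \<open>I\<close> and avoiding \<open>S\<close>.
  If \<open>a\<close> and \<open>b\<close> lay outside \<open>Q\<close>, both \<open>Q + (a)\<close> and \<open>Q + (b)\<close> would meet \<open>S\<close>; the product
  of the two elements found there is in \<open>S\<close>, and it is in \<open>Q\<close> as soon as \<open>a b\<close> is.
\<close>

lemma (in cring) exists_primeideal_avoiding:
  assumes I: "ideal I R" and IS: "I \<inter> S = {}"
    and S: "S \<subseteq> carrier R" "\<one> \<in> S" "\<And>s t. s \<in> S \<Longrightarrow> t \<in> S \<Longrightarrow> s \<otimes> t \<in> S"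
  shows "\<exists>Q. primeideal Q R \<and> I \<subseteq> Q \<and> Q \<inter> S = {}"
proof -
  define A where "A = {J. ideal J R \<and> I \<subseteq> J \<and> J \<inter> S = {}}"
  have "\<exists>Q\<in>A. \<forall>J\<in>A. Q \<subseteq> J \<longrightarrow> J = Q"
  proof (rule subset_Zorn_nonempty)
    show "A \<noteq> {}" using I IS by (auto simp: A_def)
  next
    fix C assume C: "C \<noteq> {}" "subset.chain A C"
    then have "subset.chain {J. ideal J R} C"
      unfolding pred_on.chain_def A_def by blast
    from chain_Union_is_ideal[OF this] C(1) have "ideal (\<Union>C) R" by simp
    moreover have "\<forall>J\<in>C. I \<subseteq> J \<and> J \<inter> S = {}"
      using C(2) unfolding pred_on.chain_def A_def by blast
    ultimately show "\<Union>C \<in> A" using C(1) unfolding A_def by blast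
  qed
  then obtain Q where Q: "Q \<in> A" and maxi: "\<And>J. J \<in> A \<Longrightarrow> Q \<subseteq> J \<Longrightarrow> J = Q" by blast
  then have QI: "ideal Q R" and IQ: "I \<subseteq> Q" and QS: "Q \<inter> S = {}" by (auto simp: A_def)
  interpret Q: ideal Q R by (rule QI)
  have meets: "\<exists>j\<in>Q. \<exists>u\<in>carrier R. j \<oplus> u \<otimes> a \<in> S" if a: "a \<in> carrier R" "a \<notin> Q" for a
  proof (rule ccontr)
    assume no: "\<not> ?thesis"
    define J where "J = set_add R Q (PIdl a)"
    have J: "J = {j \<oplus> u \<otimes> a |j u. j \<in> Q \<and> u \<in> carrier R}"
      unfolding J_def set_add_defs cgenideal_def by auto
    have "ideal J R" unfolding J_def by (rule add_ideals[OF QI cgenideal_ideal[OF a(1)]])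
    moreover have QJ: "Q \<subseteq> J"
    proof
      fix q assume q: "q \<in> Q"
      then have "q = q \<oplus> \<zero> \<otimes> a" using a(1) Q.a_subset by auto
      then show "q \<in> J" unfolding J using q by blast
    qed
    moreover have "J \<inter> S = {}" unfolding J using no by blast
    ultimately have "J = Q" using IQ by (intro maxi) (auto simp: A_def)
    have "a = \<zero> \<oplus> \<one> \<otimes> a" using a(1) by simp
    then have "a \<in> J" unfolding J using Q.zero_closed by blast
    then show False using \<open>J = Q\<close> a(2) by simp
  qed
  have "primeideal Q R"
  proof (rule primeidealI[OF QI is_cring])
    show "carrier R \<noteq> Q" using S(2) QS by auto
  next
    fix a b assume ab: "a \<in> carrier R" "b \<in> carrier R" "a \<otimes> b \<in> Q"
    show "a \<in> Q \<or> b \<in> Q"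
    proof (rule ccontr)
      assume "\<not> ?thesis"
      then have nab: "a \<notin> Q" "b \<notin> Q" by auto
      obtain i u where i: "i \<in> Q" and u: "u \<in> carrier R" and iS: "i \<oplus> u \<otimes> a \<in> S"
        using meets[OF ab(1) nab(1)] by blast
      obtain j v where j: "j \<in> Q" and v: "v \<in> carrier R" and jS: "j \<oplus> v \<otimes> b \<in> S"
        using meets[OF ab(2) nab(2)] by blast
      have ic: "i \<in> carrier R" and jc: "j \<in> carrier R" using i j Q.a_subset by auto
      have "(i \<oplus> u \<otimes> a) \<otimes> (j \<oplus> v \<otimes> b) =
            (j \<oplus> v \<otimes> b) \<otimes> i \<oplus> ((u \<otimes> a) \<otimes> j \<oplus> (u \<otimes> v) \<otimes> (a \<otimes> b))"
        using ab ic jc u v by algebra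
      also have "\<dots> \<in> Q"
        using ab ic jc u v i j by (intro additive_subgroup.a_closed[OF Q.is_additive_subgroup]
            Q.I_l_closed[OF i] Q.I_l_closed[OF j] Q.I_l_closed[OF ab(3)]) auto
      finally show False using S(3)[OF iS jS] QS by blast
    qed
  qed
  then show ?thesis using IQ QS by blast
qed

text \<open>
  This is the elementwise form of the statement that \<open>R\<^bsub>P\<^esub>[1/x]\<close> is the whole fraction field:
  the denominator \<open>d\<close> of any fraction divides \<open>s x\<^sup>n\<close>, hence is invertible there.
\<close>

lemma (in domain) power_multiple_if_height_le_one:
  assumes P: "primeideal P R" and ht: "height R P \<le> 1"
    and x: "x \<in> P" "x \<noteq> \<zero>" and d: "d \<in> carrier R" "d \<noteq> \<zero>"
  shows "\<exists>n::nat. \<exists>s\<in>carrier R - P. s \<otimes> x [^] n \<in> PIdl d"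
proof (rule ccontr)
  assume none: "\<not> ?thesis"
  interpret P: primeideal P R by (rule P)
  have xc: "x \<in> carrier R" using x(1) P.a_subset by auto
  define S where "S = {s \<otimes> x [^] n |s n. s \<in> carrier R - P \<and> n \<in> (UNIV :: nat set)}"
  have one: "\<one> \<notin> P" using P.one_imp_carrier P.I_notcarr by auto
  have "\<exists>Q. primeideal Q R \<and> PIdl d \<subseteq> Q \<and> Q \<inter> S = {}"
  proof (rule exists_primeideal_avoiding)
    show "ideal (PIdl d) R" by (rule cgenideal_ideal[OF d(1)])
    show "PIdl d \<inter> S = {}" using none unfolding S_def by blast
    show "S \<subseteq> carrier R" unfolding S_def using xc by auto
    have "\<one> = \<one> \<otimes> x [^] (0::nat)" by simp
    then show "\<one> \<in> S" unfolding S_def using one by blast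
  next
    fix a b assume "a \<in> S" "b \<in> S"
    then obtain s t m n where s: "s \<in> carrier R - P" "a = s \<otimes> x [^] (m::nat)"
      and t: "t \<in> carrier R - P" "b = t \<otimes> x [^] (n::nat)" unfolding S_def by blast
    have "a \<otimes> b = (s \<otimes> t) \<otimes> (x [^] m \<otimes> x [^] n)" using s t xc by (simp add: m_ac)
    also have "\<dots> = (s \<otimes> t) \<otimes> x [^] (m + n)" using xc by (simp add: nat_pow_mult)
    finally have "a \<otimes> b = (s \<otimes> t) \<otimes> x [^] (m + n)" .
    moreover have "s \<otimes> t \<in> carrier R - P" using s t P.I_prime by blast
    ultimately show "a \<otimes> b \<in> S" unfolding S_def by blast
  qed
  then obtain Q where Q: "primeideal Q R" and dQ: "PIdl d \<subseteq> Q" and QS: "Q \<inter> S = {}" by blast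
  interpret Q: primeideal Q R by (rule Q)
  \<comment> \<open>\<open>S\<close> contains the complement of \<open>P\<close> (take \<open>n = 0\<close>) and also \<open>x\<close>, so \<open>Q\<close> lies strictly
    inside \<open>P\<close>.\<close>
  have "Q \<subseteq> P"
  proof
    fix q assume q: "q \<in> Q"
    then have qc: "q \<in> carrier R" using Q.a_subset by auto
    then have "q = q \<otimes> x [^] (0::nat)" by simp
    then show "q \<in> P" using q qc QS unfolding S_def by blast
  qed
  moreover have "x \<notin> Q"
  proof -
    have "x = \<one> \<otimes> x [^] (1::nat)" using xc by simp
    then have "x \<in> S" unfolding S_def using one by blast
    then show ?thesis using QS by blast
  qed
  ultimately have QP: "Q \<subset> P" using x(1) by blast
  have "d \<in> Q" using dQ cgenideal_self[OF d(1)] by blast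
  then have ZQ: "{\<zero>} \<subset> Q" using d(2) Q.zero_closed by blast
  define F where "F i = (if i = 0 then {\<zero>} else if i = 1 then Q else P)" for i :: nat
  have "F 2 = P \<and> (\<forall>i\<le>2. primeideal (F i) R) \<and> (\<forall>i<2. F i \<subset> F (Suc i))"
    using P Q zeroprimeideal QP ZQ by (auto simp: F_def less_2_cases_iff)
  then have "enat 2 \<le> height R P"
    unfolding height_def by (intro SUP_upper) blast
  then have "enat 2 \<le> 1" using ht by (rule order_trans)
  then show False by (simp add: one_enat_def)
qed

section \<open>Mathieu subspaces of the fraction field\<close>

lemma self_module_simps [simp]:
  "carrier (self_module K) = carrier K" "monoid.mult (self_module K) = monoid.mult K"
  "one (self_module K) = one K" "ring.zero (self_module K) = ring.zero K"
  "add (self_module K) = add K" "smult (self_module K) = monoid.mult K"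
  by (simp_all add: self_module_def)

lemma self_module_nat_pow [simp]:
  "a [^]\<^bsub>self_module K\<^esub> (n::nat) = a [^]\<^bsub>K\<^esub> n"
  by (simp add: nat_pow_def)

context fraction_field
begin

lemma mathieu_subspaceD:
  assumes "mathieu_subspace (K\<lparr>carrier := R\<rparr>) (self_module K) M" "a \<in> carrier K" "b \<in> carrier K"
    and "\<And>m::nat. m \<ge> 1 \<Longrightarrow> a [^] m \<in> M"
  shows "\<exists>N::nat. \<forall>m\<ge>N. b \<otimes> a [^] m \<in> M"
  using assms unfolding mathieu_subspace_def by simp

text \<open>
  This is the extended ideal \<open>P R\<^bsub>P\<^esub>\<close>, described inside \<open>K\<close> by clearing denominators, so that
  the ring \<open>R\<^bsub>P\<^esub>\<close> itself need not be constructed.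
\<close>

definition localized_ideal :: "'a set \<Rightarrow> 'a set" where
  "localized_ideal P = {y \<in> carrier K. \<exists>s\<in>R - P. s \<otimes> y \<in> P}"

lemma domain_R: "domain (K\<lparr>carrier := R\<rparr>)"
  by (rule subdomain_is_domain[OF subdomain_axioms])

lemma primeideal_R_facts:
  assumes "primeideal P (K\<lparr>carrier := R\<rparr>)"
  shows "P \<subseteq> R" "\<zero> \<in> P" "\<one> \<notin> P"
    and "\<And>x y. x \<in> P \<Longrightarrow> y \<in> P \<Longrightarrow> x \<oplus> y \<in> P"
    and "\<And>x r. x \<in> P \<Longrightarrow> r \<in> R \<Longrightarrow> r \<otimes> x \<in> P"
    and "\<And>x y. x \<in> R - P \<Longrightarrow> y \<in> R - P \<Longrightarrow> x \<otimes> y \<in> R - P"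
proof -
  interpret P: primeideal P "K\<lparr>carrier := R\<rparr>" by (rule assms)
  show "P \<subseteq> R" using P.a_subset by simp
  show "\<zero> \<in> P" using additive_subgroup.zero_closed[OF P.is_additive_subgroup] by simp
  show "\<one> \<notin> P" using P.one_imp_carrier P.I_notcarr by auto
  show "\<And>x y. x \<in> P \<Longrightarrow> y \<in> P \<Longrightarrow> x \<oplus> y \<in> P" using additive_subgroup.a_closed[OF P.is_additive_subgroup] by simp
  show "\<And>x r. x \<in> P \<Longrightarrow> r \<in> R \<Longrightarrow> r \<otimes> x \<in> P" using P.I_l_closed by simp
  show "\<And>x y. x \<in> R - P \<Longrightarrow> y \<in> R - P \<Longrightarrow> x \<otimes> y \<in> R - P" using P.I_prime by auto
qed

lemma localized_ideal_Int:
  assumes P: "primeideal P (K\<lparr>carrier := R\<rparr>)"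
  shows "localized_ideal P \<inter> R = P"
proof (intro equalityI subsetI)
  fix y assume "y \<in> localized_ideal P \<inter> R"
  then show "y \<in> P" using primeideal_R_facts(6)[OF P] unfolding localized_ideal_def by blast
next
  fix y assume y: "y \<in> P"
  then have "y \<in> R" and "\<one> \<otimes> y = y" using primeideal_R_facts(1)[OF P] subset by auto
  moreover have "\<one> \<in> R - P" using primeideal_R_facts(3)[OF P] by auto
  ultimately have "\<exists>s\<in>R - P. s \<otimes> y \<in> P" using y by (intro bexI[of _ \<one>]) auto
  then show "y \<in> localized_ideal P \<inter> R"
    using \<open>y \<in> R\<close> subset unfolding localized_ideal_def by auto
qed

lemma submodule_localized_ideal:
  assumes P: "primeideal P (K\<lparr>carrier := R\<rparr>)"
  shows "submodule (localized_ideal P) (K\<lparr>carrier := R\<rparr>) (self_module K)"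
proof -
  note PF = primeideal_R_facts[OF P]
  have Rc: "\<And>s. s \<in> R \<Longrightarrow> s \<in> carrier K" using subset by auto
  interpret A: algebra "K\<lparr>carrier := R\<rparr>" "self_module K" by (rule self_module_algebra)
  have smult: "r \<otimes> y \<in> localized_ideal P" if r: "r \<in> R" and y: "y \<in> localized_ideal P" for r y
  proof -
    from y obtain s where s: "s \<in> R - P" "s \<otimes> y \<in> P" and yc: "y \<in> carrier K"
      unfolding localized_ideal_def by blast
    have "s \<otimes> (r \<otimes> y) = r \<otimes> (s \<otimes> y)" using Rc r s yc by (simp add: m_ac)
    then have "s \<otimes> (r \<otimes> y) \<in> P" using PF(5) s r by simp
    then show ?thesis using s Rc r yc unfolding localized_ideal_def by auto
  qed
  show ?thesis
  proof (rule A.submoduleI)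
    show "localized_ideal P \<subseteq> carrier (self_module K)"
      unfolding localized_ideal_def by auto
    show "\<zero>\<^bsub>self_module K\<^esub> \<in> localized_ideal P"
      using localized_ideal_Int[OF P] PF(2) by auto
  next
    fix y assume y: "y \<in> localized_ideal P"
    then have yc: "y \<in> carrier K" unfolding localized_ideal_def by auto
    have "\<ominus>\<^bsub>self_module K\<^esub> y = \<ominus> y" by (simp add: a_inv_def m_inv_def)
    also have "\<dots> = (\<ominus> \<one>) \<otimes> y" using yc by (simp add: l_minus)
    also have "\<dots> \<in> localized_ideal P" by (intro smult y) (use subringE(5)[OF subring_axioms] in simp)
    finally show "\<ominus>\<^bsub>self_module K\<^esub> y \<in> localized_ideal P" .
  next
    fix y z assume "y \<in> localized_ideal P" "z \<in> localized_ideal P"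
    then obtain s t where s: "s \<in> R - P" "s \<otimes> y \<in> P" and yc: "y \<in> carrier K"
      and t: "t \<in> R - P" "t \<otimes> z \<in> P" and zc: "z \<in> carrier K"
      unfolding localized_ideal_def by blast
    have sc: "s \<in> carrier K" and tc: "t \<in> carrier K" using s t Rc by auto
    have "(s \<otimes> t) \<otimes> (y \<oplus> z) = t \<otimes> (s \<otimes> y) \<oplus> s \<otimes> (t \<otimes> z)"
      using sc tc yc zc by algebra
    also have "\<dots> \<in> P" using s t by (intro PF(4) PF(5)[OF s(2)] PF(5)[OF t(2)]) auto
    finally show "y \<oplus>\<^bsub>self_module K\<^esub> z \<in> localized_ideal P"
      using PF(6)[OF s(1) t(1)] yc zc unfolding localized_ideal_def by auto
  next
    fix r y assume "r \<in> carrier (K\<lparr>carrier := R\<rparr>)" "y \<in> localized_ideal P"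
    then show "r \<odot>\<^bsub>self_module K\<^esub> y \<in> localized_ideal P" using smult by simp
  qed
qed

text \<open>
  Writing \<open>b = c / d\<close>, the denominator \<open>d\<close> divides some \<open>t x\<^sup>n\<close>, so it cancels in \<open>t b x\<^sup>n\<close>; thus
  \<open>b x\<^sup>n \<in> R\<^bsub>P\<^esub>\<close>.
\<close>

lemma mult_power_mem_localization:
  assumes P: "primeideal P (K\<lparr>carrier := R\<rparr>)" and ht: "height (K\<lparr>carrier := R\<rparr>) P \<le> 1"
    and x: "x \<in> P" "x \<noteq> \<zero>" and b: "b \<in> carrier K"
  shows "\<exists>n::nat. \<exists>t\<in>R - P. t \<otimes> (b \<otimes> x [^] n) \<in> R"
proof -
  have Rc: "\<And>s. s \<in> R \<Longrightarrow> s \<in> carrier K" using subset by auto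
  have xc: "x \<in> carrier K" using x primeideal_R_facts(1)[OF P] Rc by auto
  obtain c d where c: "c \<in> R" and d: "d \<in> R" "d \<noteq> \<zero>" and bcd: "b = c \<otimes> inv d"
    using fraction[OF b] by blast
  have dU: "d \<in> Units K" using d Rc field_Units by auto
  from domain.power_multiple_if_height_le_one[OF domain_R P ht, of x d] x d
  obtain n :: nat and t where t: "t \<in> R - P" "t \<otimes> x [^]\<^bsub>K\<lparr>carrier := R\<rparr>\<^esub> n \<in> PIdl\<^bsub>K\<lparr>carrier := R\<rparr>\<^esub> d"
    by auto
  then obtain w where w: "w \<in> R" "t \<otimes> x [^] n = w \<otimes> d"
    unfolding cgenideal_def by (auto simp flip: nat_pow_consistent)
  have "t \<otimes> (b \<otimes> x [^] n) = c \<otimes> inv d \<otimes> (t \<otimes> x [^] n)"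
    using Rc c t xc dU bcd by (simp add: m_ac)
  also have "\<dots> = c \<otimes> w \<otimes> (d \<otimes> inv d)"
    unfolding w(2) using Rc c d w(1) dU by (simp add: m_ac del: Units_r_inv)
  also have "\<dots> = c \<otimes> w" using Rc c w dU by simp
  also have "\<dots> \<in> R" using c w by simp
  finally show ?thesis using t by blast
qed

text \<open>
  An element \<open>a\<close> of \<open>P R\<^bsub>P\<^esub>\<close> becomes \<open>x = s a \<in> P\<close> after clearing its denominator. Some
  \<open>b x\<^sup>n\<close> has a denominator \<open>t\<close> outside \<open>P\<close>; one more factor \<open>x\<close> brings its numerator into \<open>P\<close>.
  Hence \<open>t s\<^sup>m\<close> is a denominator showing \<open>b a\<^sup>m \<in> P R\<^bsub>P\<^esub>\<close> for all \<open>m > n\<close>.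
\<close>

lemma mathieu_subspace_localized_ideal:
  assumes P: "primeideal P (K\<lparr>carrier := R\<rparr>)" and ht: "height (K\<lparr>carrier := R\<rparr>) P \<le> 1"
  shows "mathieu_subspace (K\<lparr>carrier := R\<rparr>) (self_module K) (localized_ideal P)"
proof -
  note PF = primeideal_R_facts[OF P]
  have Rc: "\<And>s. s \<in> R \<Longrightarrow> s \<in> carrier K" using subset by auto
  have ev: "\<exists>N::nat. \<forall>m\<ge>N. b \<otimes> a [^] m \<in> localized_ideal P"
    if a: "a \<in> localized_ideal P" and b: "b \<in> carrier K" for a b
  proof -
    from a obtain s where s: "s \<in> R - P" "s \<otimes> a \<in> P" and ac: "a \<in> carrier K"
      unfolding localized_ideal_def by blast
    have sc: "s \<in> carrier K" using s Rc by auto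
    show ?thesis
    proof (cases "a = \<zero>")
      case True
      have "b \<otimes> a [^] m \<in> localized_ideal P" if "m \<ge> 1" for m :: nat
        using that True b a by (simp add: nat_pow_zero)
      then show ?thesis by blast
    next
      case False
      define x where "x = s \<otimes> a"
      have xP: "x \<in> P" using s by (simp add: x_def)
      have "s \<noteq> \<zero>" using s PF(2) by auto
      then have x0: "x \<noteq> \<zero>" using False sc ac by (simp add: x_def integral_iff)
      have xc: "x \<in> carrier K" using sc ac by (simp add: x_def)
      obtain n :: nat and t where t: "t \<in> R - P" "t \<otimes> (b \<otimes> x [^] n) \<in> R"
        using mult_power_mem_localization[OF P ht xP x0 b] by blast
      have tc: "t \<in> carrier K" using t Rc by auto
      have numerator: "t \<otimes> (b \<otimes> x [^] (n + Suc k)) \<in> P" for k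
      proof -
        have pow: "x [^] k \<in> R" using xP PF(1) by (induction k) auto
        have "t \<otimes> (b \<otimes> x [^] (n + Suc k)) = (t \<otimes> (b \<otimes> x [^] n)) \<otimes> x [^] k \<otimes> x"
          using tc b xc by (simp add: m_assoc flip: nat_pow_mult)
        then show ?thesis using PF(5)[OF xP] t(2) pow by simp
      qed
      have "b \<otimes> a [^] m \<in> localized_ideal P" if m: "m \<ge> n + 1" for m
      proof -
        have pow: "s [^] k \<in> R - P" for k :: nat
        proof (induction k)
          case 0 then show ?case using PF(3) by simp
        next
          case (Suc k) then show ?case using PF(6) s(1) by simp
        qed
        obtain k where "m = n + 1 + k" using le_Suc_ex[OF m] by blast
        then have k: "m = n + Suc k" by simp
        have "(t \<otimes> s [^] m) \<otimes> (b \<otimes> a [^] m) = t \<otimes> (b \<otimes> (s [^] m \<otimes> a [^] m))"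
          using tc sc ac b by (simp add: m_ac)
        also have "\<dots> = t \<otimes> (b \<otimes> x [^] m)"
          unfolding x_def using sc ac by (simp add: nat_pow_distrib)
        also have "\<dots> \<in> P" using numerator k by simp
        finally show ?thesis
          using PF(6)[OF t(1) pow] b ac unfolding localized_ideal_def by blast
      qed
      then show ?thesis by blast
    qed
  qed
  show ?thesis
    unfolding mathieu_subspace_def
  proof (intro conjI submodule_localized_ideal[OF P] ballI impI)
    fix a b assume "a \<in> carrier (self_module K)" "b \<in> carrier (self_module K)"
      and pow: "\<forall>m::nat. m \<ge> 1 \<longrightarrow> a [^]\<^bsub>self_module K\<^esub> m \<in> localized_ideal P"
    moreover from this have "a \<in> localized_ideal P"
      using pow[rule_format, of 1] by simp
    ultimately show "\<exists>N::nat. \<forall>m\<ge>N. b \<otimes>\<^bsub>self_module K\<^esub> a [^]\<^bsub>self_module K\<^esub> m \<in> localized_ideal P"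
      using ev by simp
  qed
qed

text \<open>
  A common multiple \<open>c \<noteq> 0\<close> of all powers of \<open>r\<close> turns the eventual membership of
  \<open>(b / c) r\<^sup>m\<close> into membership of \<open>b\<close> itself: if \<open>c = u r\<^sup>m\<close> with \<open>u \<in> R\<close>, then
  \<open>b = u ((b / c) r\<^sup>m)\<close>.
\<close>

lemma mathieu_subspace_anti_archimedean:
  assumes M: "mathieu_subspace (K\<lparr>carrier := R\<rparr>) (self_module K) M"
    and r: "r \<in> R" "r \<in> M" and aa: "anti_archimedean (K\<lparr>carrier := R\<rparr>) r"
  shows "M = carrier K"
proof -
  have Rc: "\<And>s. s \<in> R \<Longrightarrow> s \<in> carrier K" using subset by auto
  have sub: "submodule M (K\<lparr>carrier := R\<rparr>) (self_module K)"
    using M unfolding mathieu_subspace_def by blast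
  have smult: "u \<otimes> y \<in> M" if "u \<in> R" "y \<in> M" for u y
    using submodule.smult_closed[OF sub, of u y] that by simp
  have "M \<subseteq> carrier K"
    using subgroup.subset[OF submodule.axioms(1)[OF sub]] by simp
  have pow: "r [^] m \<in> M" if m: "m \<ge> 1" for m :: nat
  proof -
    obtain k where "m = Suc k" using m by (cases m) auto
    moreover have "r [^] k \<in> R" using r by (induction k) auto
    ultimately show ?thesis using smult r by simp
  qed
  let ?I = "\<lambda>n::nat. PIdl\<^bsub>K\<lparr>carrier := R\<rparr>\<^esub> (r [^]\<^bsub>K\<lparr>carrier := R\<rparr>\<^esub> n)"
  have I: "?I n = {u \<otimes> r [^] n |u. u \<in> R}" for n
    unfolding cgenideal_def by (simp flip: nat_pow_consistent)
  have "\<zero> \<in> ?I n" for n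
    unfolding I using r Rc subringE(2)[OF subring_axioms] by (intro CollectI exI[of _ \<zero>]) simp
  then have "\<zero> \<in> (\<Inter>n\<in>{1..}. ?I n)" by blast
  moreover have "(\<Inter>n\<in>{1..}. ?I n) \<noteq> {\<zero>}"
    using aa unfolding anti_archimedean_def by simp
  ultimately obtain c where "c \<noteq> \<zero>" "c \<in> (\<Inter>n\<in>{1..}. ?I n)" by blast
  then have c: "c \<noteq> \<zero>" "\<And>n. n \<ge> 1 \<Longrightarrow> c \<in> ?I n" by simp_all
  have cc: "c \<in> carrier K" using c(2)[of 1] Rc r unfolding I by auto
  then have cU: "c \<in> Units K" using c(1) field_Units by auto
  have "b \<in> M" if b: "b \<in> carrier K" for b
  proof -
    have "b \<otimes> inv c \<in> carrier K" using b cU by simp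
    from mathieu_subspaceD[OF M Rc[OF r(1)] this pow]
    obtain N :: nat where N: "\<And>m. m \<ge> N \<Longrightarrow> b \<otimes> inv c \<otimes> r [^] m \<in> M" by blast
    \<comment> \<open>The exponent is \<open>Suc N\<close>, as only positive powers of \<open>r\<close> are known to divide \<open>c\<close>.\<close>
    obtain u where u: "u \<in> R" "c = u \<otimes> r [^] Suc N" using c(2)[of "Suc N"] unfolding I by auto
    have "b \<otimes> inv c \<otimes> c = b \<otimes> (inv c \<otimes> c)" using b cc cU by (intro m_assoc) auto
    also have "\<dots> = b" using b cU by (simp only: Units_l_inv r_one)
    finally have "b = b \<otimes> inv c \<otimes> c" by (rule sym)
    also have "\<dots> = b \<otimes> inv c \<otimes> (u \<otimes> r [^] Suc N)" using u(2) by simp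
    also have "\<dots> = u \<otimes> (b \<otimes> inv c \<otimes> r [^] Suc N)"
      using b cU Rc[OF u(1)] Rc[OF r(1)] by (simp add: m_ac del: nat_pow_Suc)
    also have "\<dots> \<in> M" by (intro smult u N) simp
    finally show ?thesis .
  qed
  then show ?thesis using \<open>M \<subseteq> carrier K\<close> by blast
qed

end

theorem theorem4p3:
  fixes K :: "('a, 'b) ring_scheme" and R :: "'a set"
  assumes "fraction_field R K"
  shows "(\<forall>P. primeideal P (K\<lparr>carrier := R\<rparr>) \<and> height (K\<lparr>carrier := R\<rparr>) P = 1 \<longrightarrow>
            (\<exists>M. mathieu_subspace (K\<lparr>carrier := R\<rparr>) (self_module K) M \<and> P = M \<inter> R)) \<and>
         (\<forall>r\<in>R. anti_archimedean (K\<lparr>carrier := R\<rparr>) r \<longrightarrow>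
            \<not> (\<exists>M. mathieu_subspace (K\<lparr>carrier := R\<rparr>) (self_module K) M \<and>
                   M \<noteq> carrier K \<and> r \<in> M))"
proof -
  interpret fraction_field R K by (rule assms)
  show ?thesis
  proof (intro conjI allI ballI impI)
    fix P assume P: "primeideal P (K\<lparr>carrier := R\<rparr>) \<and> height (K\<lparr>carrier := R\<rparr>) P = 1"
    then have "mathieu_subspace (K\<lparr>carrier := R\<rparr>) (self_module K) (localized_ideal P)"
      by (intro mathieu_subspace_localized_ideal) auto
    moreover have "P = localized_ideal P \<inter> R" using P localized_ideal_Int by blast
    ultimately show "\<exists>M. mathieu_subspace (K\<lparr>carrier := R\<rparr>) (self_module K) M \<and> P = M \<inter> R"
      by blast
  next
    fix r assume "r \<in> R" "anti_archimedean (K\<lparr>carrier := R\<rparr>) r"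
    then show "\<not> (\<exists>M. mathieu_subspace (K\<lparr>carrier := R\<rparr>) (self_module K) M \<and>
                   M \<noteq> carrier K \<and> r \<in> M)"
      using mathieu_subspace_anti_archimedean by blast
  qed
qed

end
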